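(* Let $\Omega\subsetneq\mathbb{R}^n$ be open with $R:=\sup_{x\in\Omega}d(x)<\infty$. For all $u\in C_c^\infty(\Omega)$, all $s\ge n$ and all $\gamma>1$, $$\int_\Omega\frac{|\nabla u|}{d^{s-1}}dx\ \ge\ (s-n)\int_\Omega\frac{|u|}{d^s}dx+\frac{C}{R^{s-n}}\int_\Omega\frac{|u|}{d^n}X^\gamma\Big(\frac dR\Big)dx$$ holds with a constant $C\ge\gamma-1$.
   Context: $d(x):=\operatorname{dist}(x,\mathbb{R}^n\setminus\Omega)$; $X(t):=(1-\log t)^{-1}$ for $t\in(0,1]$. *)

theory Defs
  imports "HOL-Analysis.Analysis"
begin

definition dOm :: "'a::euclidean_space set \<Rightarrow> 'a \<Rightarrow> real" where
  "dOm \<Omega> x = infdist x (- \<Omega>)"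

definition Xfun :: "real \<Rightarrow> real" where
  "Xfun t = 1 / (1 - ln t)"

definition grad :: "('a::euclidean_space \<Rightarrow> real) \<Rightarrow> 'a \<Rightarrow> 'a" where
  "grad u x = (\<Sum>b\<in>Basis. frechet_derivative u (at x) b *\<^sub>R b)"

fun Ck :: "nat \<Rightarrow> ('a::euclidean_space \<Rightarrow> real) \<Rightarrow> bool" where
  "Ck 0 f = continuous_on UNIV f"
| "Ck (Suc k) f = ((\<forall>x. f differentiable (at x)) \<and>
      (\<forall>b\<in>Basis. Ck k (\<lambda>x. frechet_derivative f (at x) b)))"

definition smooth :: "('a::euclidean_space \<Rightarrow> real) \<Rightarrow> bool" where
  "smooth f = (\<forall>k. Ck k f)"

text \<open>C_c^infinity(Omega): smooth functions whose support (closure of the nonzero set)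
  is compact and contained in Omega (identified with their zero extension).\<close>
definition Cc_inf :: "'a::euclidean_space set \<Rightarrow> ('a \<Rightarrow> real) set" where
  "Cc_inf \<Omega> = {u. smooth u \<and> compact (closure {x. u x \<noteq> 0}) \<and> closure {x. u x \<noteq> 0} \<subseteq> \<Omega>}"

end

theory Submission
  imports Defs
begin

text \<open>
  Let \<open>n\<close> be the dimension and \<open>\<psi> t = t\<^bsup>n-s\<^esup> - R\<^bsup>n-s\<^esup> X(t/R)\<^bsup>\<gamma>-1\<^esup>\<close>; it decreases to \<open>0\<close> on
  \<open>(0, R]\<close> and is bounded by \<open>t\<^bsup>n-s\<^esup>\<close>, and with \<open>C = \<gamma> - 1\<close> the right-hand side is the integral of
  \<open>|u| d\<^bsup>1-n\<^esup> (-\<psi>'(d))\<close>. So it suffices to bound this by the integral of \<open>|\<nabla>u| d\<^bsup>1-n\<^esup> \<psi>(d)\<close>. When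
  \<open>d\<close> is the distance to a single point this is integration by parts along rays, and it remains
  true on every set that is star-shaped about that point, because the boundary term has the right
  sign. Voronoi cells of a finite point set are star-shaped about their centres, so the bound holds
  for the distance to a finite set. The distance to the complement of \<open>\<Omega>\<close> is the limit of the
  distances to the first \<open>N\<close> points of a dense sequence; these may exceed \<open>R\<close>, so Fatou's lemma is
  used once with a radius \<open>r > R\<close> and once more for \<open>r \<rightarrow> R\<close>.
\<close>

section \<open>The gradient of a smooth function\<close>

lemma smooth_imp_differentiable: "smooth u \<Longrightarrow> u differentiable (at x)"
  unfolding smooth_def by (metis Ck.simps(2))

lemma has_derivative_grad:
  assumes "smooth u"
  shows "(u has_derivative (\<lambda>h. grad u x \<bullet> h)) (at x)"
proof -
  let ?D = "frechet_derivative u (at x)"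
  have D: "(u has_derivative ?D) (at x)"
    using smooth_imp_differentiable[OF assms] by (simp add: frechet_derivative_works)
  then interpret linear ?D
    by (rule has_derivative_linear)
  have "?D h = grad u x \<bullet> h" for h
  proof -
    have "?D h = ?D (\<Sum>b\<in>Basis. (h \<bullet> b) *\<^sub>R b)"
      by (simp add: euclidean_representation)
    also have "\<dots> = h \<bullet> grad u x"
      by (simp add: sum scale grad_def inner_sum_right mult.commute)
    also have "\<dots> = grad u x \<bullet> h"
      by (rule inner_commute)
    finally show ?thesis .
  qed
  with D show ?thesis
    by (metis (no_types, lifting) ext)
qed

lemma continuous_on_grad:
  assumes "smooth u"
  shows "continuous_on A (grad u)"
proof -
  have "Ck (Suc 0) u"
    using assms by (simp add: smooth_def)
  then have "continuous_on UNIV (grad u)"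
    unfolding grad_def by (auto intro!: continuous_intros)
  then show ?thesis
    by (rule continuous_on_subset) simp
qed

section \<open>Integration along rays from a single point\<close>

text \<open>Fundamental theorem of calculus on the segment from \<open>p\<close> to
  \<open>x\<close>, then Cauchy-Schwarz. The bound is a nonnegative Lebesgue integral, so that the
  order of integration can later be exchanged freely.\<close>

lemma abs_le_nn_integral_ray:
  fixes u :: "'a::euclidean_space \<Rightarrow> real" and g :: "'a \<Rightarrow> 'a"
  assumes deriv: "\<And>x. (u has_derivative (\<lambda>h. g x \<bullet> h)) (at x)"
    and cont: "continuous_on UNIV g" and p: "u p = 0"
  shows "ennreal \<bar>u x\<bar> \<le> (\<integral>\<^sup>+\<tau>. indicator {0..1} \<tau> *
           ennreal (norm (g (p + \<tau> *\<^sub>R (x - p))) * norm (x - p)) \<partial>lborel)"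
proof -
  let ?l = "\<lambda>\<tau>. p + \<tau> *\<^sub>R (x - p)"
  let ?f = "\<lambda>\<tau>. g (?l \<tau>) \<bullet> (x - p)"
  let ?F = "\<lambda>\<tau>. norm (g (?l \<tau>)) * norm (x - p)"
  have cg: "continuous_on S (\<lambda>\<tau>. g (?l \<tau>))" for S :: "real set"
    by (rule continuous_on_compose2[OF cont]) (auto intro!: continuous_intros)
  have "((\<lambda>\<tau>. u (?l \<tau>)) has_vector_derivative ?f \<tau>) (at \<tau> within {0..1})" for \<tau>
  proof -
    have "((\<lambda>\<tau>. ?l \<tau>) has_derivative (\<lambda>h. h *\<^sub>R (x - p))) (at \<tau> within {0..1})"
      by (auto intro!: derivative_eq_intros)
    from has_derivative_compose[OF this deriv] show ?thesis
      by (simp add: has_vector_derivative_def)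
  qed
  then have I: "(?f has_integral (u (?l 1) - u (?l 0))) {0..1}"
    by (intro fundamental_theorem_of_calculus) auto
  have F: "?F integrable_on {0..1}"
    by (intro integrable_continuous_real continuous_intros cg)
  have "\<bar>u x\<bar> = norm (integral {0..1} ?f)"
    using integral_unique[OF I] p by simp
  also have "\<dots> \<le> integral {0..1} ?F"
    by (intro integral_norm_bound_integral F has_integral_integrable[OF I])
       (simp add: Cauchy_Schwarz_ineq2)
  finally have "ennreal \<bar>u x\<bar> \<le> ennreal (integral {0..1} ?F)"
    by (rule ennreal_leI)
  also have "\<dots> = (\<integral>\<^sup>+\<tau>. ennreal (indicator {0..1} \<tau> * ?F \<tau>) \<partial>lborel)"
    by (rule nn_integral_has_integral_lebesgue[OF _ integrable_integral[OF F], symmetric]) simp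
  also have "\<dots> = (\<integral>\<^sup>+\<tau>. indicator {0..1} \<tau> * ennreal (?F \<tau>) \<partial>lborel)"
    by (intro nn_integral_cong) (auto simp: indicator_def)
  finally show ?thesis .
qed

text \<open>Change of variables for the dilation about \<open>p\<close> by the factor 1/\<tau>,
  whose Jacobian is \<tau>^(-n) in dimension n.\<close>

lemma nn_integral_homothety:
  fixes f :: "'a::euclidean_space \<Rightarrow> ennreal"
  assumes f: "f \<in> borel_measurable borel" and "\<tau> > 0"
  shows "(\<integral>\<^sup>+x. f x \<partial>lborel) =
         (\<integral>\<^sup>+y. ennreal ((1 / \<tau>) ^ DIM('a)) * f (p + (1 / \<tau>) *\<^sub>R (y - p)) \<partial>lborel)"
proof -
  let ?T = "\<lambda>y. (p - (1 / \<tau>) *\<^sub>R p) + (1 / \<tau>) *\<^sub>R y"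
  have "(\<integral>\<^sup>+x. f x \<partial>lborel) =
      (\<integral>\<^sup>+x. f x \<partial>density (distr lborel borel ?T) (\<lambda>_. \<bar>1 / \<tau>\<bar> ^ DIM('a)))"
    using assms by (subst lborel_affine[of "1 / \<tau>" "p - (1 / \<tau>) *\<^sub>R p"]) auto
  also have "\<dots> = (\<integral>\<^sup>+y. ennreal (\<bar>1 / \<tau>\<bar> ^ DIM('a)) * f (?T y) \<partial>lborel)"
    using f by (simp add: nn_integral_density nn_integral_distr)
  finally show ?thesis
    using \<open>\<tau> > 0\<close> by (simp add: algebra_simps)
qed

text \<open>Weight the ray bound for |u| by \<open>h\<close> and integrate over \<open>V\<close>:
  each point y at radius r collects contributions from the points of \<open>V\<close> further out on
  its ray, up to radius \<open>R\<close>. They add up to at most the integral of \<open>h\<close>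
  from r to \<open>R\<close>, which is \<psi>(r) - \<psi>(R). The factor r^(1-n) compensates for the
  growth of spheres.\<close>

lemma star_cell_estimate:
  fixes u :: "'a::euclidean_space \<Rightarrow> real" and g :: "'a \<Rightarrow> 'a" and h \<psi> :: "real \<Rightarrow> real"
  assumes deriv: "\<And>x. (u has_derivative (\<lambda>h. g x \<bullet> h)) (at x)"
    and cont: "continuous_on UNIV g" and p: "u p = 0"
    and V[measurable]: "V \<in> sets borel"
    and star: "\<And>x \<tau>. x \<in> V \<Longrightarrow> 0 < \<tau> \<Longrightarrow> \<tau> \<le> 1 \<Longrightarrow> p + \<tau> *\<^sub>R (x - p) \<in> V"
    and h[measurable]: "h \<in> borel_measurable borel"
    and h_nonneg: "\<And>t. 0 < t \<Longrightarrow> t \<le> R \<Longrightarrow> 0 \<le> h t"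
    and \<psi>: "\<And>t. 0 < t \<Longrightarrow> t \<le> R \<Longrightarrow> (\<psi> has_real_derivative - h t) (at t)"
    and \<psi>R: "\<psi> R \<ge> 0"
  shows "(\<integral>\<^sup>+x. indicator V x * (indicator {0<..R} (dist x p) *
             ennreal (\<bar>u x\<bar> * (dist x p powr (1 - real DIM('a)) * h (dist x p)))) \<partial>lborel)
       \<le> (\<integral>\<^sup>+x. indicator V x * (indicator {0<..R} (dist x p) *
             ennreal (norm (g x) * (dist x p powr (1 - real DIM('a)) * \<psi> (dist x p)))) \<partial>lborel)"
proof -
  let ?n = "real DIM('a)"
  have [measurable]: "g \<in> borel_measurable borel"
    using cont by (rule borel_measurable_continuous_onI)
  have "continuous_on UNIV u"
    using deriv by (meson continuous_at_imp_continuous_on has_derivative_continuous)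
  then have [measurable]: "u \<in> borel_measurable borel"
    by (rule borel_measurable_continuous_onI)
  define k where "k r = indicator {0<..R} r * ennreal (r powr (1 - ?n) * h r)" for r
  have [measurable]: "k \<in> borel_measurable borel"
    unfolding k_def by measurable
  \<comment> \<open>The value \<tau> = 0, where the dilation degenerates, is left out; it is a null
    set.\<close>
  define F where "F x \<tau> = indicator V x * k (dist x p) * (indicator {0<..1} \<tau> *
      ennreal (norm (g (p + \<tau> *\<^sub>R (x - p))) * norm (x - p)))" for x \<tau>
  have F_meas[measurable]: "case_prod F \<in> borel_measurable (lborel \<Otimes>\<^sub>M lborel)"
    unfolding F_def by measurable
  \<comment> \<open>The lower limit for \<tau> says that the original point, at distance
    \<open>dist y p / \<tau>\<close> from \<open>p\<close>, is no further away than
    \<open>R\<close>.\<close>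
  define G where "G y \<tau> = indicator V y * (indicator {0<..R} (dist y p) *
      ennreal (norm (g y) * dist y p powr (1 - ?n))) *
      (ennreal (dist y p / \<tau>\<^sup>2 * h (dist y p / \<tau>)) * indicator {dist y p / R..1} \<tau>)" for y \<tau>
  \<comment> \<open>The interval for \<tau> depends on \<open>y\<close>; unfolding its indicator
    into inequalities makes joint measurability provable.\<close>
  have G_meas[measurable]: "case_prod G \<in> borel_measurable (lborel \<Otimes>\<^sub>M lborel)"
    unfolding G_def indicator_def atLeastAtMost_iff by measurable
  \<comment> \<open>Substitute \<open>y = p + \<tau> (x - p)\<close>, which maps \<open>V\<close> into itself; \<open>\<integral> G y \<tau> d\<tau>\<close> is then evaluated
    through the antiderivative \<open>\<tau> \<mapsto> \<psi> (dist y p / \<tau>)\<close>.\<close>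
  have sc: "(\<integral>\<^sup>+x. F x \<tau> \<partial>lborel) \<le> (\<integral>\<^sup>+y. G y \<tau> \<partial>lborel)" for \<tau>
  proof (cases "0 < \<tau> \<and> \<tau> \<le> 1")
    case True
    then have \<tau>: "0 < \<tau>" "\<tau> \<le> 1" by auto
    have "(\<integral>\<^sup>+x. F x \<tau> \<partial>lborel) =
        (\<integral>\<^sup>+y. ennreal ((1 / \<tau>) ^ DIM('a)) * F (p + (1 / \<tau>) *\<^sub>R (y - p)) \<tau> \<partial>lborel)"
      using \<tau> by (intro nn_integral_homothety) measurable
    also have "\<dots> \<le> (\<integral>\<^sup>+y. G y \<tau> \<partial>lborel)"
    proof (intro nn_integral_mono)
      fix y
      let ?x = "p + (1 / \<tau>) *\<^sub>R (y - p)" and ?r = "dist y p"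
      have dx: "dist ?x p = ?r / \<tau>" "norm (?x - p) = ?r / \<tau>"
        using \<tau> by (simp_all add: dist_norm)
      have yx: "p + \<tau> *\<^sub>R (?x - p) = y"
        using \<tau> by simp
      show "ennreal ((1 / \<tau>) ^ DIM('a)) * F ?x \<tau> \<le> G y \<tau>"
      proof (cases "?x \<in> V \<and> 0 < ?r / \<tau> \<and> ?r / \<tau> \<le> R")
        case True
        then have r: "0 < ?r" "?r / \<tau> \<le> R"
          using \<tau> by (auto simp: zero_less_divide_iff)
        have "R > 0"
          using True by linarith
        \<comment> \<open>Star-shapedness enters here: \<open>y\<close> lies on the segment from
          \<open>p\<close> to \<open>?x\<close>.\<close>
        have "y \<in> V"
          using star[of ?x \<tau>] True \<tau> yx by auto
        have rR: "?r / R \<le> \<tau>" "?r \<le> R"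
        proof -
          show "?r / R \<le> \<tau>"
            using r \<tau> \<open>R > 0\<close> by (simp add: field_simps)
          have "?r \<le> \<tau> * R"
            using r \<tau> by (simp add: field_simps)
          also have "\<dots> \<le> 1 * R"
            using \<tau> \<open>R > 0\<close> by (intro mult_right_mono) auto
          finally show "?r \<le> R" by simp
        qed
        have h0: "h (?r / \<tau>) \<ge> 0"
          using r \<tau> by (intro h_nonneg) auto
        \<comment> \<open>This is the purpose of the exponent 1 - n: \<tau>^(-n) from the Jacobian
          and \<tau>^(n-1) from the weight leave 1/\<tau>, and the length of the ray gives another
          1/\<tau>.\<close>
        have e: "(1 / \<tau>) ^ DIM('a) * ((?r / \<tau>) powr (1 - ?n) * (?r / \<tau>))
            = ?r powr (1 - ?n) * (?r / \<tau>\<^sup>2)"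
        proof -
          have a: "(1 / \<tau>) ^ DIM('a) = \<tau> powr (- ?n)"
            using \<tau> by (simp add: powr_minus powr_realpow power_one_over field_simps)
          have b: "(?r / \<tau>) powr (1 - ?n) = ?r powr (1 - ?n) * \<tau> powr (?n - 1)"
            using \<tau> r by (simp add: powr_divide powr_diff field_simps)
          have c: "\<tau> powr (- ?n) * \<tau> powr (?n - 1) = 1 / \<tau>"
            using \<tau> powr_add[of \<tau> "- ?n" "?n - 1", symmetric] by (simp add: powr_minus_divide)
          have "(1 / \<tau>) ^ DIM('a) * ((?r / \<tau>) powr (1 - ?n) * (?r / \<tau>))
              = (\<tau> powr (- ?n) * \<tau> powr (?n - 1)) * (?r powr (1 - ?n) * (?r / \<tau>))"
            unfolding a b by (simp only: ac_simps)
          then show ?thesis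
            unfolding c by (simp add: power2_eq_square)
        qed
        have "(1 / \<tau>) ^ DIM('a) * (((?r / \<tau>) powr (1 - ?n) * h (?r / \<tau>)) * (norm (g y) * (?r / \<tau>)))
            = ((1 / \<tau>) ^ DIM('a) * ((?r / \<tau>) powr (1 - ?n) * (?r / \<tau>))) * (norm (g y) * h (?r / \<tau>))"
          by (simp only: ac_simps)
        also have "\<dots> = (norm (g y) * ?r powr (1 - ?n)) * (?r / \<tau>\<^sup>2 * h (?r / \<tau>))"
          unfolding e by (simp only: ac_simps)
        finally have eq: "(1 / \<tau>) ^ DIM('a) * (((?r / \<tau>) powr (1 - ?n) * h (?r / \<tau>)) * (norm (g y) * (?r / \<tau>)))
            = (norm (g y) * ?r powr (1 - ?n)) * (?r / \<tau>\<^sup>2 * h (?r / \<tau>))" .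
        have "ennreal ((1 / \<tau>) ^ DIM('a)) * F ?x \<tau> =
            ennreal ((1 / \<tau>) ^ DIM('a)) * (ennreal ((?r / \<tau>) powr (1 - ?n) * h (?r / \<tau>)) *
              ennreal (norm (g y) * (?r / \<tau>)))"
          unfolding F_def k_def dx yx using True \<tau> by simp
        also have "\<dots> = ennreal ((1 / \<tau>) ^ DIM('a) * (((?r / \<tau>) powr (1 - ?n) * h (?r / \<tau>)) *
            (norm (g y) * (?r / \<tau>))))"
          using h0 \<tau> r by (simp only: ennreal_mult'' mult_nonneg_nonneg powr_ge_zero norm_ge_zero
              zero_le_power divide_nonneg_nonneg less_imp_le zero_le_one)
        also have "\<dots> = ennreal (norm (g y) * ?r powr (1 - ?n)) * ennreal (?r / \<tau>\<^sup>2 * h (?r / \<tau>))"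
          unfolding eq by (rule ennreal_mult') simp
        also have "\<dots> = G y \<tau>"
          unfolding G_def using \<open>y \<in> V\<close> r rR \<tau> by simp
        finally show ?thesis by simp
      next
        case False
        then have "F ?x \<tau> = 0"
          unfolding F_def k_def dx by (auto simp: indicator_def)
        then show ?thesis by simp
      qed
    qed
    finally show ?thesis .
  next
    case False
    then have "F x \<tau> = 0" for x
      by (auto simp: F_def indicator_def)
    then show ?thesis by simp
  qed
  have "(\<integral>\<^sup>+x. indicator V x * (indicator {0<..R} (dist x p) *
             ennreal (\<bar>u x\<bar> * (dist x p powr (1 - ?n) * h (dist x p)))) \<partial>lborel)
      \<le> (\<integral>\<^sup>+x. \<integral>\<^sup>+\<tau>. F x \<tau> \<partial>lborel \<partial>lborel)"
  proof (intro nn_integral_mono)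
    fix x
    have "indicator V x * (indicator {0<..R} (dist x p) *
             ennreal (\<bar>u x\<bar> * (dist x p powr (1 - ?n) * h (dist x p))))
        = indicator V x * k (dist x p) * ennreal \<bar>u x\<bar>"
      unfolding k_def using h_nonneg[of "dist x p"]
      by (auto simp: indicator_def ennreal_mult''[symmetric] mult_ac)
    also have "\<dots> \<le> indicator V x * k (dist x p) * (\<integral>\<^sup>+\<tau>. indicator {0..1} \<tau> *
           ennreal (norm (g (p + \<tau> *\<^sub>R (x - p))) * norm (x - p)) \<partial>lborel)"
      by (intro mult_left_mono abs_le_nn_integral_ray deriv cont p) auto
    also have "\<dots> = indicator V x * k (dist x p) * (\<integral>\<^sup>+\<tau>. indicator {0<..1} \<tau> *
           ennreal (norm (g (p + \<tau> *\<^sub>R (x - p))) * norm (x - p)) \<partial>lborel)"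
      by (rule arg_cong[OF nn_integral_cong_AE], rule AE_mp[OF AE_lborel_singleton[of 0]])
         (auto simp: indicator_def)
    also have "\<dots> = (\<integral>\<^sup>+\<tau>. F x \<tau> \<partial>lborel)"
      unfolding F_def by (intro nn_integral_cmult[symmetric]) measurable
    finally show "indicator V x * (indicator {0<..R} (dist x p) *
             ennreal (\<bar>u x\<bar> * (dist x p powr (1 - ?n) * h (dist x p))))
        \<le> (\<integral>\<^sup>+\<tau>. F x \<tau> \<partial>lborel)" .
  qed
  also have "\<dots> = (\<integral>\<^sup>+\<tau>. \<integral>\<^sup>+x. F x \<tau> \<partial>lborel \<partial>lborel)"
    by (rule lborel_pair.Fubini'[OF F_meas, symmetric])
  also have "\<dots> \<le> (\<integral>\<^sup>+\<tau>. \<integral>\<^sup>+y. G y \<tau> \<partial>lborel \<partial>lborel)"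
    by (intro nn_integral_mono sc)
  also have "\<dots> = (\<integral>\<^sup>+y. \<integral>\<^sup>+\<tau>. G y \<tau> \<partial>lborel \<partial>lborel)"
    by (rule lborel_pair.Fubini'[OF G_meas])
  also have "\<dots> \<le> (\<integral>\<^sup>+x. indicator V x * (indicator {0<..R} (dist x p) *
             ennreal (norm (g x) * (dist x p powr (1 - ?n) * \<psi> (dist x p)))) \<partial>lborel)"
  proof (intro nn_integral_mono)
    fix y
    let ?r = "dist y p"
    let ?A = "indicator V y * (indicator {0<..R} ?r * ennreal (norm (g y) * ?r powr (1 - ?n))) :: ennreal"
    have "(\<integral>\<^sup>+\<tau>. G y \<tau> \<partial>lborel) = ?A *
        (\<integral>\<^sup>+\<tau>. ennreal (?r / \<tau>\<^sup>2 * h (?r / \<tau>)) * indicator {?r / R..1} \<tau> \<partial>lborel)"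
      unfolding G_def by (intro nn_integral_cmult) measurable
    also have "\<dots> \<le> ?A * ennreal (\<psi> ?r)"
    proof (cases "0 < ?r \<and> ?r \<le> R")
      case True
      then have r: "0 < ?r" "?r \<le> R" and "R > 0" by linarith+
      have "(\<integral>\<^sup>+\<tau>. ennreal (?r / \<tau>\<^sup>2 * h (?r / \<tau>)) * indicator {?r / R..1} \<tau> \<partial>lborel)
          = ennreal (\<psi> (?r / 1) - \<psi> (?r / (?r / R)))"
      proof (intro nn_integral_FTC_Icc)
        fix \<tau> assume "\<tau> \<in> {?r / R..1}"
        then have \<tau>: "?r / R \<le> \<tau>" "\<tau> \<le> 1" by auto
        have "0 < ?r / R"
          using r \<open>R > 0\<close> by simp
        then have "\<tau> > 0" using \<tau> by linarith
        then have b: "0 < ?r / \<tau>" "?r / \<tau> \<le> R"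
          using r \<tau> \<open>R > 0\<close> by (auto simp: field_simps)
        have "((\<lambda>\<tau>. ?r / \<tau>) has_real_derivative - (?r / \<tau>\<^sup>2)) (at \<tau>)"
          using \<open>\<tau> > 0\<close> by (auto intro!: derivative_eq_intros simp: power2_eq_square)
        from DERIV_chain2[OF \<psi>[OF b] this]
        show "((\<lambda>\<tau>. \<psi> (?r / \<tau>)) has_real_derivative ?r / \<tau>\<^sup>2 * h (?r / \<tau>)) (at \<tau>)"
          by (simp add: mult.commute)
        show "0 \<le> ?r / \<tau>\<^sup>2 * h (?r / \<tau>)"
          using b h_nonneg by simp
      qed (use r \<open>R > 0\<close> in \<open>auto simp: divide_le_eq\<close>)
      also have "\<dots> \<le> ennreal (\<psi> ?r)"
        using r \<psi>R by (intro ennreal_leI) simp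
      finally show ?thesis
        by (intro mult_left_mono) auto
    next
      case False
      then have A: "?A = 0" by (auto simp: indicator_def)
      show ?thesis unfolding A by simp
    qed
    also have "\<dots> = indicator V y * (indicator {0<..R} ?r *
             ennreal (norm (g y) * (?r powr (1 - ?n) * \<psi> ?r)))"
      by (simp add: ennreal_mult'[symmetric] mult.assoc)
    finally show "(\<integral>\<^sup>+\<tau>. G y \<tau> \<partial>lborel) \<le> indicator V y * (indicator {0<..R} ?r *
             ennreal (norm (g y) * (?r powr (1 - ?n) * \<psi> ?r)))" .
  qed
  finally show ?thesis .
qed

section \<open>Distance to a finite set\<close>

text \<open>On the cell of \<open>y i\<close> the function \<open>e\<close> is the distance to
  \<open>y i\<close> alone, so the star-shaped estimate applies there; the cells partition the space
  and the estimates add up.\<close>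

lemma voronoi_estimate:
  fixes u :: "'a::euclidean_space \<Rightarrow> real" and g :: "'a \<Rightarrow> 'a" and h \<psi> :: "real \<Rightarrow> real"
    and y :: "nat \<Rightarrow> 'a" and N :: nat
  defines "e \<equiv> \<lambda>x. infdist x (y ` {..N})"
  assumes deriv: "\<And>x. (u has_derivative (\<lambda>h. g x \<bullet> h)) (at x)"
    and cont: "continuous_on UNIV g" and u0: "\<And>i. u (y i) = 0"
    and h[measurable]: "h \<in> borel_measurable borel"
    and \<psi>_meas[measurable]: "\<psi> \<in> borel_measurable borel"
    and h_nonneg: "\<And>t. 0 < t \<Longrightarrow> t \<le> R \<Longrightarrow> 0 \<le> h t"
    and \<psi>: "\<And>t. 0 < t \<Longrightarrow> t \<le> R \<Longrightarrow> (\<psi> has_real_derivative - h t) (at t)"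
    and \<psi>R: "\<psi> R \<ge> 0"
  shows "(\<integral>\<^sup>+x. indicator {0<..R} (e x) *
             ennreal (\<bar>u x\<bar> * (e x powr (1 - real DIM('a)) * h (e x))) \<partial>lborel)
       \<le> (\<integral>\<^sup>+x. indicator {0<..R} (e x) *
             ennreal (norm (g x) * (e x powr (1 - real DIM('a)) * \<psi> (e x))) \<partial>lborel)"
proof -
  let ?n = "real DIM('a)"
  have [measurable]: "g \<in> borel_measurable borel"
    using cont by (rule borel_measurable_continuous_onI)
  have "continuous_on UNIV u"
    using deriv by (meson continuous_at_imp_continuous_on has_derivative_continuous)
  then have [measurable]: "u \<in> borel_measurable borel"
    by (rule borel_measurable_continuous_onI)
  \<comment> \<open>Ties are broken by index, which makes the cells disjoint while keeping them star-shaped.\<close>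
  define V where "V i = {x. \<forall>j\<in>{..N}. dist x (y i) \<le> dist x (y j) \<and>
      (j < i \<longrightarrow> dist x (y i) < dist x (y j))}" for i
  have V_meas[measurable]: "V i \<in> sets borel" for i
    unfolding V_def by measurable
  have star: "y i + \<tau> *\<^sub>R (x - y i) \<in> V i" if x: "x \<in> V i" and \<tau>: "0 < \<tau>" "\<tau> \<le> 1" for i x \<tau>
  proof -
    let ?z = "y i + \<tau> *\<^sub>R (x - y i)"
    have 1: "dist ?z (y i) = \<tau> * dist x (y i)"
      using \<tau> by (simp add: dist_norm)
    have "x - ?z = (1 - \<tau>) *\<^sub>R (x - y i)"
      by (simp add: algebra_simps)
    then have 2: "dist x ?z = (1 - \<tau>) * dist x (y i)"
      using \<tau> by (simp add: dist_norm)
    \<comment> \<open>Moving from \<open>x\<close> to \<open>?z\<close> shortens the distance to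
      \<open>y i\<close> by exactly \<open>(1 - \<tau>) * dist x (y i)\<close> and the distance to
      any \<open>y j\<close> by at most that much. Hence both the weak and the strict inequalities
      that define the cell survive.\<close>
    have "dist x (y j) \<le> (1 - \<tau>) * dist x (y i) + dist ?z (y j)" for j
      using dist_triangle[of x "y j" ?z] 2 by simp
    then have "dist ?z (y i) + (dist x (y j) - dist x (y i)) \<le> dist ?z (y j)" for j
      unfolding 1 by (simp add: algebra_simps)
    then show ?thesis
      using x unfolding V_def by (smt (verit) mem_Collect_eq)
  qed
  have e_cell: "e x = dist x (y i)" if "x \<in> V i" "i \<le> N" for x i
  proof -
    have "infdist x (y ` {..N}) = (INF a\<in>y ` {..N}. dist x a)"
      by (simp add: infdist_def)
    also have "\<dots> = dist x (y i)"
      using that by (intro cInf_eq_minimum) (auto simp: V_def)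
    finally show ?thesis by (simp add: e_def)
  qed
  have ex_cell: "\<exists>i\<le>N. x \<in> V i" for x
  proof -
    define m where "m = Min ((\<lambda>j. dist x (y j)) ` {..N})"
    have "m \<in> (\<lambda>j. dist x (y j)) ` {..N}"
      unfolding m_def by (intro Min_in) auto
    then have ex: "\<exists>i. i \<le> N \<and> dist x (y i) = m" by auto
    \<comment> \<open>Among the nearest centres the one of smallest index satisfies the tie-breaking
      rule.\<close>
    define i where "i = (LEAST i. i \<le> N \<and> dist x (y i) = m)"
    have i: "i \<le> N" "dist x (y i) = m"
      using LeastI_ex[OF ex] by (auto simp: i_def)
    have le: "m \<le> dist x (y j)" if "j \<le> N" for j
      unfolding m_def using that by (intro Min_le) auto
    have "m < dist x (y j)" if "j \<le> N" "j < i" for j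
      using not_less_Least[of j "\<lambda>i. i \<le> N \<and> dist x (y i) = m"] that le[of j]
      by (auto simp: i_def)
    then have "x \<in> V i"
      using i le by (simp add: V_def)
    then show ?thesis
      using i by blast
  qed
  have disj: "i = j" if "x \<in> V i" "x \<in> V j" "i \<le> N" "j \<le> N" for x i j
    using that unfolding V_def
    by (metis (no_types, lifting) atMost_iff linorder_neqE_nat mem_Collect_eq not_le)
  \<comment> \<open>Exactly one cell contains \<open>x\<close>, and there the distance to the centre
    is \<open>e x\<close>.\<close>
  have split: "(\<Sum>i\<le>N. indicator (V i) x * (f (dist x (y i)) x :: ennreal)) = f (e x) x" for f x
  proof -
    obtain i where i: "i \<le> N" "x \<in> V i"
      using ex_cell by blast
    have "(\<Sum>j\<le>N. indicator (V j) x * f (dist x (y j)) x) = (\<Sum>j\<in>{i}. indicator (V j) x * f (dist x (y j)) x)"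
      using i disj by (intro sum.mono_neutral_right) (auto simp: indicator_def)
    then show ?thesis
      using i e_cell by simp
  qed
  have "(\<integral>\<^sup>+x. indicator {0<..R} (e x) *
             ennreal (\<bar>u x\<bar> * (e x powr (1 - ?n) * h (e x))) \<partial>lborel)
      = (\<Sum>i\<le>N. \<integral>\<^sup>+x. indicator (V i) x * (indicator {0<..R} (dist x (y i)) *
          ennreal (\<bar>u x\<bar> * (dist x (y i) powr (1 - ?n) * h (dist x (y i))))) \<partial>lborel)"
    by (subst nn_integral_sum[symmetric], measurable)
       (subst split[where f = "\<lambda>r x. indicator {0<..R} r * ennreal (\<bar>u x\<bar> * (r powr (1 - ?n) * h r))"], rule refl)
  also have "\<dots> \<le> (\<Sum>i\<le>N. \<integral>\<^sup>+x. indicator (V i) x * (indicator {0<..R} (dist x (y i)) *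
          ennreal (norm (g x) * (dist x (y i) powr (1 - ?n) * \<psi> (dist x (y i))))) \<partial>lborel)"
    by (intro sum_mono star_cell_estimate deriv cont u0 V_meas star h h_nonneg \<psi> \<psi>R)
  also have "\<dots> = (\<integral>\<^sup>+x. indicator {0<..R} (e x) *
             ennreal (norm (g x) * (e x powr (1 - ?n) * \<psi> (e x))) \<partial>lborel)"
    by (subst nn_integral_sum[symmetric], measurable)
       (subst split[where f = "\<lambda>r x. indicator {0<..R} r * ennreal (norm (g x) * (r powr (1 - ?n) * \<psi> r))"], rule refl)
  finally show ?thesis .
qed

section \<open>Limits and comparison of integrals\<close>

text \<open>Some point of \<open>S\<close> almost realises the distance and some \<open>y n\<close>
  is close to it; adding further points cannot increase the distance, and lying inside
  \<open>S\<close> bounds it from below.\<close>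

lemma infdist_tendsto_dense:
  fixes y :: "nat \<Rightarrow> 'a::metric_space"
  assumes "range y \<subseteq> S" "S \<subseteq> closure (range y)"
  shows "(\<lambda>N. infdist x (y ` {..N})) \<longlonglongrightarrow> infdist x S"
proof (rule LIMSEQ_I)
  fix r :: real assume "r > 0"
  have ne: "S \<noteq> {}" using assms by auto
  have "\<exists>a\<in>S. dist x a < infdist x S + r / 2"
    using ne \<open>r > 0\<close> cInf_less_iff[of "dist x ` S" "infdist x S + r / 2"]
    by (auto simp: infdist_def)
  then obtain a where a: "a \<in> S" "dist x a < infdist x S + r / 2" by blast
  moreover obtain n where "dist (y n) a < r / 2"
    using a assms(2) \<open>r > 0\<close> closure_approachable[of a "range y"]
    by (metis half_gt_zero rangeE subsetD)
  ultimately have n: "dist x (y n) < infdist x S + r"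
    using dist_triangle[of x "y n" a] by (simp add: dist_commute)
  have "norm (infdist x (y ` {..N}) - infdist x S) < r" if "N \<ge> n" for N
  proof -
    have "infdist x (y ` {..N}) \<le> dist x (y n)"
      using that by (intro infdist_le) auto
    moreover have "infdist x S \<le> infdist x (y ` {..N})"
      using assms by (intro infdist_mono) auto
    ultimately show ?thesis using n by simp
  qed
  then show "\<exists>no. \<forall>N\<ge>no. norm (infdist x (y ` {..N}) - infdist x S) < r" by blast
qed

text \<open>Fatou's lemma in the form used for both limits: a uniform bound on the integrals passes
  to the pointwise limit without a dominating function.\<close>

lemma nn_integral_limit_le:
  fixes f :: "nat \<Rightarrow> 'a \<Rightarrow> ennreal"
  assumes "\<And>i. f i \<in> borel_measurable M" "\<And>x. (\<lambda>i. f i x) \<longlonglongrightarrow> F x"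
    and "\<And>i. (\<integral>\<^sup>+x. f i x \<partial>M) \<le> B"
  shows "(\<integral>\<^sup>+x. F x \<partial>M) \<le> B"
proof -
  have "(\<integral>\<^sup>+x. F x \<partial>M) = (\<integral>\<^sup>+x. liminf (\<lambda>i. f i x) \<partial>M)"
    using assms(2) by (intro nn_integral_cong lim_imp_Liminf[symmetric]) auto
  also have "\<dots> \<le> liminf (\<lambda>i. \<integral>\<^sup>+x. f i x \<partial>M)"
    by (rule nn_integral_liminf) (rule assms)
  also have "\<dots> \<le> limsup (\<lambda>i. \<integral>\<^sup>+x. f i x \<partial>M)"
    by (rule Liminf_le_Limsup) simp
  also have "\<dots> \<le> B"
    by (rule Limsup_bounded) (simp add: assms)
  finally show ?thesis .
qed

text \<open>Bridge between the gauge integrals over \<Omega> in the theorem and the nonnegative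
  Lebesgue integrals over the whole space in the estimates.\<close>

lemma nn_integral_eq_integral_compact_support:
  fixes f :: "'a::euclidean_space \<Rightarrow> real"
  assumes "compact K" "continuous_on K f" "K \<subseteq> A" "\<And>x. x \<notin> K \<Longrightarrow> f x = 0" "\<And>x. f x \<ge> 0"
  shows "f integrable_on A" "(\<integral>\<^sup>+x. ennreal (f x) \<partial>lborel) = ennreal (integral A f)"
proof -
  have "(\<lambda>x. indicator K x *\<^sub>R f x) = f"
    using assms(4) by (force simp: indicator_def)
  then have "integrable lborel f"
    using borel_integrable_compact[OF assms(1,2)] by simp
  then have "(f has_integral (\<integral>x. f x \<partial>lborel)) UNIV"
    by (rule has_integral_integral_lborel)
  then have U: "f integrable_on UNIV"
    by blast
  have eq: "(\<lambda>x. if x \<in> A then f x else 0) = f"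
    using assms(3,4) by force
  show "f integrable_on A"
    using integrable_restrict_UNIV[of A f] U eq by simp
  have "integral A f = integral UNIV f"
    using integral_restrict_UNIV[of A f] eq by simp
  moreover have "(\<integral>\<^sup>+x. ennreal (f x) * indicator UNIV x \<partial>lborel) = ennreal (integral UNIV f)"
    by (rule nn_integral_has_integral_lebesgue'[OF _ integrable_integral[OF U]]) (rule assms)
  ultimately show "(\<integral>\<^sup>+x. ennreal (f x) \<partial>lborel) = ennreal (integral A f)"
    by simp
qed

section \<open>The logarithmic weight and its antiderivative\<close>

lemma Xfun_pos: "ln t < 1 \<Longrightarrow> Xfun t > 0"
  by (simp add: Xfun_def)

lemma Xfun_measurable[measurable]: "Xfun \<in> borel_measurable borel"
  unfolding Xfun_def by measurable

text \<open>The derivative of X(t/R) is X(t/R)^2 / t. The power rule lowers the exponent \<gamma> -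
  1 by one and the square raises it by two.\<close>

lemma Xfun_powr_has_derivative:
  assumes "0 < t" "0 < R" "ln (t / R) < 1"
  shows "((\<lambda>t. Xfun (t / R) powr (\<gamma> - 1)) has_real_derivative
           (\<gamma> - 1) * Xfun (t / R) powr \<gamma> / t) (at t)"
proof -
  let ?X = "Xfun (t / R)"
  have X: "?X > 0" using assms(3) by (rule Xfun_pos)
  have d: "((\<lambda>t. Xfun (t / R)) has_real_derivative ?X\<^sup>2 / t) (at t)"
    unfolding Xfun_def using assms
    by (auto intro!: derivative_eq_intros simp: power2_eq_square divide_simps)
  have "((\<lambda>t. Xfun (t / R) powr (\<gamma> - 1)) has_real_derivative
          (\<gamma> - 1) * ?X powr (\<gamma> - 1 - 1) * (?X\<^sup>2 / t)) (at t)"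
    using DERIV_chain2[OF has_real_derivative_powr[OF X] d] .
  moreover have "?X powr (\<gamma> - 1 - 1) * ?X\<^sup>2 = ?X powr \<gamma>"
    using X by (simp add: powr_diff power2_eq_square)
  ultimately show ?thesis
    by (simp add: mult.assoc)
qed


text \<open>This is -\<psi>' for \<psi>(t) = t^(n-s) - R^(n-s) X(t/R)^(\<gamma>-1). Multiplied by
  t^(1-n) it becomes the combined weight of the two right-hand integrals with C = \<gamma> -
  1.\<close>

definition hardy_weight :: "real \<Rightarrow> real \<Rightarrow> real \<Rightarrow> real \<Rightarrow> real \<Rightarrow> real" where
  "hardy_weight n s \<gamma> R t = (s - n) * t powr (n - s - 1) +
     (\<gamma> - 1) * R powr (n - s) * (Xfun (t / R) powr \<gamma> / t)"

lemma hardy_weight_nonneg: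
  "n \<le> s \<Longrightarrow> 1 \<le> \<gamma> \<Longrightarrow> 0 \<le> t \<Longrightarrow> 0 \<le> hardy_weight n s \<gamma> R t"
  unfolding hardy_weight_def by (intro add_nonneg_nonneg mult_nonneg_nonneg) auto

lemma hardy_weight_measurable[measurable]: "hardy_weight n s \<gamma> R \<in> borel_measurable borel"
  unfolding hardy_weight_def[abs_def] by measurable

lemma ln_divide_less_one:
  assumes "0 < t" "t \<le> R"
  shows "ln (t / R) < (1::real)"
  using assms by (smt (verit) divide_le_eq_1 divide_pos_pos ln_le_zero_iff)

text \<open>Distance and radius may both vary, so this serves the limit of the distances at a fixed
  radius as well as the limit of the radii at a fixed distance.\<close>

lemma hardy_weight_tendsto:
  assumes "a \<longlonglongrightarrow> t" "r \<longlonglongrightarrow> R" "0 < t" "t \<le> R"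
  shows "(\<lambda>k. hardy_weight n s \<gamma> (r k) (a k)) \<longlonglongrightarrow> hardy_weight n s \<gamma> R t"
proof -
  have "1 - ln (t / R) \<noteq> 0"
    using ln_divide_less_one[OF assms(3,4)] by simp
  moreover have "t \<noteq> 0" "R \<noteq> 0" "t / R \<noteq> 0"
    using assms by auto
  ultimately show ?thesis
    unfolding hardy_weight_def Xfun_def using assms by (intro tendsto_intros) auto
qed

lemma hardy_weight_antiderivative:
  assumes "0 < t" "t \<le> R"
  shows "((\<lambda>t. t powr (n - s) - R powr (n - s) * Xfun (t / R) powr (\<gamma> - 1))
           has_real_derivative - hardy_weight n s \<gamma> R t) (at t)"
proof -
  have "((\<lambda>t. t powr (n - s)) has_real_derivative (n - s) * t powr (n - s - 1)) (at t)"
    using has_real_derivative_powr[OF assms(1)] .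
  from DERIV_diff[OF this DERIV_cmult[OF Xfun_powr_has_derivative[of t R \<gamma>], of "R powr (n - s)"]]
  show ?thesis
    using assms ln_divide_less_one[OF assms] by (simp add: hardy_weight_def algebra_simps diff_divide_distrib)
qed

section \<open>Distance to a closed set\<close>

text \<open>The distances to finite subsets of \<open>S\<close> are at least the distance to
  \<open>S\<close>, and the power with exponent 1 - s is nonincreasing. So the right-hand sides of
  the finite estimates share one bound, and Fatou's lemma handles the left-hand sides.\<close>

lemma weighted_hardy_nn_integral:
  fixes u :: "'a::euclidean_space \<Rightarrow> real" and g :: "'a \<Rightarrow> 'a" and S :: "'a set"
  assumes deriv: "\<And>x. (u has_derivative (\<lambda>h. g x \<bullet> h)) (at x)"
    and cont: "continuous_on UNIV g"
    and S: "closed S" "S \<noteq> {}" and u0: "\<And>x. x \<in> S \<Longrightarrow> u x = 0" and g0: "\<And>x. x \<in> S \<Longrightarrow> g x = 0"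
    and R: "R > 0" "\<And>x. u x \<noteq> 0 \<Longrightarrow> infdist x S \<le> R"
    and s: "s \<ge> real DIM('a)" and \<gamma>: "\<gamma> > 1"
  shows "(\<integral>\<^sup>+x. ennreal (\<bar>u x\<bar> * (infdist x S powr (1 - real DIM('a)) *
            hardy_weight (real DIM('a)) s \<gamma> R (infdist x S))) \<partial>lborel)
       \<le> (\<integral>\<^sup>+x. ennreal (norm (g x) * infdist x S powr (1 - s)) \<partial>lborel)"
proof -
  let ?n = "real DIM('a)" and ?d = "\<lambda>x. infdist x S"
  let ?B = "\<integral>\<^sup>+x. ennreal (norm (g x) * ?d x powr (1 - s)) \<partial>lborel"
  have [measurable]: "g \<in> borel_measurable borel"
    using cont by (rule borel_measurable_continuous_onI)
  have "continuous_on UNIV u"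
    using deriv by (meson continuous_at_imp_continuous_on has_derivative_continuous)
  then have [measurable]: "u \<in> borel_measurable borel"
    by (rule borel_measurable_continuous_onI)
  have inf_meas[measurable]: "(\<lambda>x. infdist x A) \<in> borel_measurable borel" for A :: "'a set"
    by (intro borel_measurable_continuous_onI continuous_intros)
  have d_pos: "?d x > 0" if "x \<notin> S" for x
    using that S by (intro infdist_pos_not_in_closed) auto
  obtain T where T: "countable T" "T \<subseteq> S" "S \<subseteq> closure T"
    using separable by blast
  define y where "y = from_nat_into T"
  have "T \<noteq> {}"
    using T S by auto
  then have ry: "range y = T"
    unfolding y_def using T by (simp add: range_from_nat_into)
  define e where "e N x = infdist x (y ` {..N})" for N x
  have [measurable]: "e N \<in> borel_measurable borel" for N
    unfolding e_def[abs_def] by measurable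
  have e_lim: "(\<lambda>N. e N x) \<longlonglongrightarrow> ?d x" for x
    unfolding e_def using T ry by (intro infdist_tendsto_dense) auto
  have e_ge: "?d x \<le> e N x" for N x
    unfolding e_def using T ry by (intro infdist_mono) auto
  \<comment> \<open>The slack r > R ensures that \<open>e N x\<close> eventually falls below r
    wherever u is nonzero, so the cut-off disappears in the limit. With r = R, \<open>e N x\<close>
    could stay above R for all N at points of distance R.\<close>
  have larger: "(\<integral>\<^sup>+x. ennreal (\<bar>u x\<bar> * (?d x powr (1 - ?n) * hardy_weight ?n s \<gamma> r (?d x))) \<partial>lborel) \<le> ?B"
    if "r > R" for r
  proof (rule nn_integral_limit_le)
    let ?f = "\<lambda>N x. indicator {0<..r} (e N x) *
        ennreal (\<bar>u x\<bar> * (e N x powr (1 - ?n) * hardy_weight ?n s \<gamma> r (e N x)))"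
    let ?\<psi> = "\<lambda>t. t powr (?n - s) - r powr (?n - s) * Xfun (t / r) powr (\<gamma> - 1)"
    show "?f N \<in> borel_measurable lborel" for N
      by measurable
    show "(\<lambda>N. ?f N x) \<longlonglongrightarrow> ennreal (\<bar>u x\<bar> * (?d x powr (1 - ?n) * hardy_weight ?n s \<gamma> r (?d x)))" for x
    proof (cases "u x = 0")
      case False
      then have d: "0 < ?d x" "?d x < r"
        using d_pos u0 R(2)[OF False] \<open>r > R\<close> by (auto simp: less_le_trans)
      have "eventually (\<lambda>N. e N x \<in> {0<..<r}) sequentially"
        using topological_tendstoD[OF e_lim, of "{0<..<r}" x] d by auto
      then have ev: "eventually (\<lambda>N. ennreal (\<bar>u x\<bar> * (e N x powr (1 - ?n) * hardy_weight ?n s \<gamma> r (e N x))) = ?f N x)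
          sequentially"
        by eventually_elim auto
      have "(\<lambda>N. ennreal (\<bar>u x\<bar> * (e N x powr (1 - ?n) * hardy_weight ?n s \<gamma> r (e N x))))
          \<longlonglongrightarrow> ennreal (\<bar>u x\<bar> * (?d x powr (1 - ?n) * hardy_weight ?n s \<gamma> r (?d x)))"
        using d by (intro tendsto_ennrealI tendsto_intros e_lim hardy_weight_tendsto) auto
      then show ?thesis
        by (rule Lim_transform_eventually) (rule ev)
    qed simp
    show "(\<integral>\<^sup>+x. ?f N x \<partial>lborel) \<le> ?B" for N
    proof -
      have "(\<integral>\<^sup>+x. ?f N x \<partial>lborel) \<le> (\<integral>\<^sup>+x. indicator {0<..r} (e N x) *
             ennreal (norm (g x) * (e N x powr (1 - ?n) * ?\<psi> (e N x))) \<partial>lborel)"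
        unfolding e_def
      proof (rule voronoi_estimate[OF deriv cont])
        show "u (y i) = 0" for i
          using T ry u0 by auto
        show "0 \<le> hardy_weight ?n s \<gamma> r t" if "0 < t" for t
          using that s \<gamma> by (intro hardy_weight_nonneg) auto
        \<comment> \<open>Since X(1) = 1, \<psi> vanishes at the radius r.\<close>
        show "0 \<le> ?\<psi> r"
          using \<open>r > R\<close> R by (simp add: Xfun_def)
      qed (use hardy_weight_antiderivative in \<open>auto\<close>)
      also have "\<dots> \<le> ?B"
      proof (intro nn_integral_mono)
        fix x
        show "indicator {0<..r} (e N x) * ennreal (norm (g x) * (e N x powr (1 - ?n) * ?\<psi> (e N x)))
            \<le> ennreal (norm (g x) * ?d x powr (1 - s))"
        proof (cases "x \<in> S \<or> e N x \<notin> {0<..r}")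
          case True
          then show ?thesis using g0 by auto
        next
          case False
          then have e: "0 < e N x" and d: "0 < ?d x"
            using d_pos by auto
          \<comment> \<open>The subtracted logarithmic term is nonnegative and is discarded.\<close>
          have "e N x powr (1 - ?n) * ?\<psi> (e N x) \<le> e N x powr (1 - ?n) * e N x powr (?n - s)"
            by (intro mult_left_mono) auto
          also have "\<dots> = e N x powr (1 - s)"
            by (simp add: powr_add[symmetric])
          also have "\<dots> \<le> ?d x powr (1 - s)"
          proof (rule powr_mono2')
            show "1 - s \<le> 0"
              using s DIM_positive[where 'a = 'a] by linarith
          qed (use d e_ge in auto)
          finally show ?thesis
            using False by (auto intro!: ennreal_leI mult_left_mono)
        qed
      qed
      finally show ?thesis .
    qed
  qed
  show ?thesis
  proof (rule nn_integral_limit_le)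
    \<comment> \<open>Radii above R that tend to R remove the slack.\<close>
    let ?r = "\<lambda>k. R + 1 / real (Suc k)"
    let ?f = "\<lambda>k x. ennreal (\<bar>u x\<bar> * (?d x powr (1 - ?n) * hardy_weight ?n s \<gamma> (?r k) (?d x)))"
    show "?f k \<in> borel_measurable lborel" for k
      by measurable
    show "(\<integral>\<^sup>+x. ?f k x \<partial>lborel) \<le> ?B" for k
      by (rule larger) simp
    have r: "?r \<longlonglongrightarrow> R"
      using tendsto_add[OF tendsto_const[of R] lim_inverse_n'[THEN LIMSEQ_Suc]] by simp
    show "(\<lambda>k. ?f k x) \<longlonglongrightarrow> ennreal (\<bar>u x\<bar> * (?d x powr (1 - ?n) * hardy_weight ?n s \<gamma> R (?d x)))" for x
    proof (cases "u x = 0")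
      case False
      then have "0 < ?d x" "?d x \<le> R"
        using d_pos u0 R(2) by auto
      then show ?thesis
        by (intro tendsto_ennrealI tendsto_intros hardy_weight_tendsto r) auto
    qed simp
  qed
qed

section \<open>The inequality on \<Omega>\<close>

theorem theorem2p5:
  fixes \<Omega> :: "'a::euclidean_space set"
  assumes "open \<Omega>" and "\<Omega> \<noteq> UNIV"
    and "bdd_above (dOm \<Omega> ` \<Omega>)"
  defines "R \<equiv> Sup (dOm \<Omega> ` \<Omega>)"
  shows "\<forall>u\<in>Cc_inf \<Omega>. \<forall>s::real. \<forall>\<gamma>::real.
           s \<ge> real DIM('a) \<longrightarrow> \<gamma> > 1 \<longrightarrow>
           (\<exists>C\<ge>\<gamma> - 1.
             integral \<Omega> (\<lambda>x. norm (grad u x) / dOm \<Omega> x powr (s - 1))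
             \<ge> (s - real DIM('a)) * integral \<Omega> (\<lambda>x. \<bar>u x\<bar> / dOm \<Omega> x powr s)
               + C / R powr (s - real DIM('a)) *
                 integral \<Omega> (\<lambda>x. \<bar>u x\<bar> / dOm \<Omega> x powr real DIM('a)
                                   * Xfun (dOm \<Omega> x / R) powr \<gamma>))"
proof (intro ballI allI impI exI[of _ "_ - 1"] conjI)
  \<comment> \<open>The witness is C = \<gamma> - 1; the placeholder in the introduction rule stands
    for \<gamma>.\<close>
  fix u :: "'a \<Rightarrow> real" and s \<gamma> :: real
  assume u: "u \<in> Cc_inf \<Omega>" and s: "s \<ge> real DIM('a)" and \<gamma>: "\<gamma> > 1"
  let ?n = "real DIM('a)" and ?d = "dOm \<Omega>"
  define K where "K = closure {x. u x \<noteq> 0}"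
  have smooth: "smooth u" and K: "compact K" "K \<subseteq> \<Omega>"
    using u by (auto simp: Cc_inf_def K_def)
  have u0: "u x = 0" if "x \<notin> K" for x
    using that closure_subset[of "{x. u x \<noteq> 0}"] by (auto simp: K_def)
  have g0: "grad u x = 0" if "x \<notin> K" for x
  proof -
    have "open (- K)" using K by (simp add: compact_imp_closed open_Compl)
    then have "(u has_derivative (\<lambda>h. 0)) (at x)"
      using that u0 by (intro has_derivative_transform_within_open[OF has_derivative_const[of 0]]) auto
    then have "(\<lambda>h. grad u x \<bullet> h) = (\<lambda>h. 0)"
      using has_derivative_unique has_derivative_grad[OF smooth] by blast
    then show ?thesis by (metis inner_eq_zero_iff)
  qed
  have d_pos: "?d x > 0" if "x \<in> \<Omega>" for x
    unfolding dOm_def using that assms(1,2) by (intro infdist_pos_not_in_closed) auto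
  have d_le: "?d x \<le> R" if "x \<in> \<Omega>" for x
    unfolding R_def using that assms(3) by (intro cSUP_upper) auto
  define f1 where "f1 = (\<lambda>x. norm (grad u x) / ?d x powr (s - 1))"
  define f2 where "f2 = (\<lambda>x. \<bar>u x\<bar> / ?d x powr s)"
  define f3 where "f3 = (\<lambda>x. \<bar>u x\<bar> / ?d x powr ?n * Xfun (?d x / R) powr \<gamma>)"
  have "(s - ?n) * integral \<Omega> f2 + (\<gamma> - 1) / R powr (s - ?n) * integral \<Omega> f3 \<le> integral \<Omega> f1"
  \<comment> \<open>For empty \<Omega> all integrals vanish; otherwise some point has positive
    distance, which gives R > 0.\<close>
  proof (cases "\<Omega> = {}")
    case False
    then have "R > 0"
      using d_pos d_le by (meson all_not_in_conv less_le_trans)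
    have cd: "continuous_on K ?d"
      unfolding dOm_def[abs_def] by (intro continuous_intros)
    \<comment> \<open>The weights may be singular at the boundary of \<Omega>, but on the compact
      support the distance and the denominator of X are nonzero, so the integrands are continuous
      there.\<close>
    have dne: "?d x \<noteq> 0" "1 - ln (?d x / R) \<noteq> 0" if "x \<in> K" for x
      using that K d_pos[of x] d_le[of x] ln_divide_less_one[of "?d x" R] by auto
    have "continuous_on UNIV u"
      using has_derivative_grad[OF smooth]
      by (meson continuous_at_imp_continuous_on has_derivative_continuous)
    then have cu: "continuous_on K u"
      by (rule continuous_on_subset) simp
    note cg = continuous_on_grad[OF smooth, of K]
    have c1: "continuous_on K f1" and c2: "continuous_on K f2" and c3: "continuous_on K f3"
      unfolding f1_def f2_def f3_def Xfun_def using dne \<open>R > 0\<close>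
      by (intro continuous_intros cd cu cg; force)+
    define F where "F x = (s - ?n) * f2 x + (\<gamma> - 1) / R powr (s - ?n) * f3 x" for x
    have cF: "continuous_on K F"
      unfolding F_def[abs_def] by (intro continuous_intros c2 c3)
    have nn: "f1 x \<ge> 0" "f2 x \<ge> 0" "f3 x \<ge> 0" for x
      by (auto simp: f1_def f2_def f3_def)
    have Fnn: "F x \<ge> 0" for x
      unfolding F_def using nn s \<gamma> by (intro add_nonneg_nonneg mult_nonneg_nonneg) auto
    have off: "f1 x = 0" "f2 x = 0" "f3 x = 0" if "x \<notin> K" for x
      using u0[OF that] g0[OF that] by (auto simp: f1_def f2_def f3_def)
    have Foff: "F x = 0" if "x \<notin> K" for x
      using off[OF that] by (simp add: F_def)
    note I = nn_integral_eq_integral_compact_support[OF K(1) _ K(2)]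
    \<comment> \<open>The right-hand integrand is brought into the form of the general estimate; off
      the support both sides are zero.\<close>
    have Feq: "F x = \<bar>u x\<bar> * (?d x powr (1 - ?n) * hardy_weight ?n s \<gamma> R (?d x))" for x
    proof (cases "x \<in> K")
      case True
      then have d: "?d x > 0" using d_pos K by auto
      have a: "?d x powr (1 - ?n) * ?d x powr (?n - s - 1) = 1 / ?d x powr s"
        using d by (simp add: powr_add[symmetric] powr_minus_divide)
      have b: "?d x powr (1 - ?n) / ?d x = 1 / ?d x powr ?n"
        using d by (simp add: powr_diff)
      have c: "R powr (?n - s) = 1 / R powr (s - ?n)"
        using powr_minus_divide[of R "s - ?n"] by simp
      have "?d x powr (1 - ?n) * hardy_weight ?n s \<gamma> R (?d x) =
          (s - ?n) * (?d x powr (1 - ?n) * ?d x powr (?n - s - 1)) +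
          (\<gamma> - 1) * R powr (?n - s) * (Xfun (?d x / R) powr \<gamma> * (?d x powr (1 - ?n) / ?d x))"
        by (simp add: hardy_weight_def algebra_simps diff_divide_distrib)
      then show ?thesis
        unfolding a b c by (simp add: F_def f2_def f3_def algebra_simps)
    qed (use Foff u0 in auto)
    have "ennreal (integral \<Omega> F) = (\<integral>\<^sup>+x. ennreal (F x) \<partial>lborel)"
      by (rule I(2)[symmetric]) (use cF Foff Fnn in auto)
    also have "\<dots> \<le> (\<integral>\<^sup>+x. ennreal (norm (grad u x) * ?d x powr (1 - s)) \<partial>lborel)"
      unfolding Feq dOm_def
    proof (rule weighted_hardy_nn_integral[OF has_derivative_grad[OF smooth]
          continuous_on_grad[OF smooth] _ _ _ _ \<open>R > 0\<close> _ s \<gamma>])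
      show "infdist x (- \<Omega>) \<le> R" if "u x \<noteq> 0" for x
        using d_le[of x] u0[of x] K that by (auto simp: dOm_def)
    qed (use assms(1,2) u0 g0 K in auto)
    also have "\<dots> = (\<integral>\<^sup>+x. ennreal (f1 x) \<partial>lborel)"
      using powr_minus_divide[of "?d _" "s - 1"] by (simp add: f1_def)
    also have "\<dots> = ennreal (integral \<Omega> f1)"
      by (rule I(2)) (use c1 off nn in auto)
    \<comment> \<open>Cancelling \<open>ennreal\<close>, which sends negative reals to 0, requires
      the integral of \<open>f1\<close> to be nonnegative.\<close>
    finally have "integral \<Omega> F \<le> integral \<Omega> f1"
      using nn by (subst (asm) ennreal_le_iff) (auto intro!: integral_nonneg I(1) c1 off)
    moreover have "integral \<Omega> F = (s - ?n) * integral \<Omega> f2 + (\<gamma> - 1) / R powr (s - ?n) * integral \<Omega> f3"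
    proof -
      have i: "f2 integrable_on \<Omega>" "f3 integrable_on \<Omega>"
        by (intro I(1) c2 c3 off nn; assumption)+
      show ?thesis
        unfolding F_def[abs_def]
        by (simp only: integral_mult_right
              integral_add[OF integrable_on_mult_right[OF i(1)] integrable_on_mult_right[OF i(2)]])
    qed
    ultimately show ?thesis by simp
  qed simp
  then show "(s - ?n) * integral \<Omega> (\<lambda>x. \<bar>u x\<bar> / ?d x powr s) + (\<gamma> - 1) / R powr (s - ?n) *
        integral \<Omega> (\<lambda>x. \<bar>u x\<bar> / ?d x powr ?n * Xfun (?d x / R) powr \<gamma>)
      \<le> integral \<Omega> (\<lambda>x. norm (grad u x) / ?d x powr (s - 1))"
    by (simp only: f1_def f2_def f3_def)
qed simp

end
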